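(* Let $q,d,n,k$ be nonnegative integers with $q\ge d$. Then the generalized Stirling number $\left\{{n\atop k}\right\}_{q,d}$ is given by $$\left\{{n\atop k}\right\}_{q,d}=\sum_{\substack{a\in\mathsf{M}(n)\\ \sum_{i,j}a_{i,j}=nd-k}}\frac{\prod_i(d)_{r_i(a)}\cdot\prod_j(q)_{c_j(a)}}{\prod_{i,j}(a_{i,j}!)},$$ where $\mathsf{M}(n)$ is the set of all lower triangular arrays $a=(a_{i,j})_{1\le j<i\le n}$ of nonnegative integers, with $c_j(a)=\sum_i a_{i,j}$ (column sums, $1\le j\le n-1$) and $r_i(a)=\sum_j a_{i,j}$ (row sums, $2\le i\le n$).
   Context: $(q)_m=q(q-1)\cdots(q-m+1)$ denotes the falling factorial, with $(q)_0=1$. Generalized Stirling numbers: let $\partial_x=\frac{d}{dx}$ act on $\mathbb{Z}[x]$, and let $x$ act by multiplication. For $q\ge d$, the numbers $\left\{{n\atop k}\right\}_{q,d}$ are the coefficients determined by the operator identity $$(x^q\partial_x^d)^n=x^{(q-d)n}\sum_k\left\{{n\atop k}\right\}_{q,d}x^k\partial_x^k .$$ *)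

theory Defs
  imports Complex_Main "HOL-Computational_Algebra.Polynomial"
begin

definition ffact :: "nat \<Rightarrow> nat \<Rightarrow> int" where
  "ffact q m = (\<Prod>i<m. int q - int i)"

text \<open>The operator \<open>x^q \<partial>^d\<close> on \<open>\<int>[x]\<close>.\<close>

definition xD :: "nat \<Rightarrow> nat \<Rightarrow> int poly \<Rightarrow> int poly" where
  "xD q d p = monom 1 q * (pderiv ^^ d) p"

text \<open>
  The sum over all \<open>k\<close> in the defining operator identity is finite: the coefficient
  families have finite support, and the sum is taken over that support.
\<close>

definition stirling_coeffs :: "nat \<Rightarrow> nat \<Rightarrow> nat \<Rightarrow> (nat \<Rightarrow> int) \<Rightarrow> bool" where
  "stirling_coeffs q d n S \<longleftrightarrow>
     finite {k. S k \<noteq> 0} \<and>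
     (\<forall>p. (xD q d ^^ n) p =
        monom 1 ((q - d) * n) * (\<Sum>k | S k \<noteq> 0. smult (S k) (xD k k p)))"

text \<open>Only meaningful for \<open>d \<le> q\<close>, since \<open>q - d\<close> above is truncated subtraction.\<close>

definition gen_stirling :: "nat \<Rightarrow> nat \<Rightarrow> nat \<Rightarrow> nat \<Rightarrow> int" where
  "gen_stirling q d n = (THE S. stirling_coeffs q d n S)"

definition tri_index :: "nat \<Rightarrow> (nat \<times> nat) set" where
  "tri_index n = {(i, j). 1 \<le> j \<and> j < i \<and> i \<le> n}"

text \<open>
  An array indexed by \<open>1 \<le> j < i \<le> n\<close> is a function that vanishes off these index pairs,
  so that equality of arrays is equality of functions.
\<close>

definition tri_arrays :: "nat \<Rightarrow> (nat \<Rightarrow> nat \<Rightarrow> nat) set" where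
  "tri_arrays n = {a. \<forall>i j. (i, j) \<notin> tri_index n \<longrightarrow> a i j = 0}"

definition row_sum :: "(nat \<Rightarrow> nat \<Rightarrow> nat) \<Rightarrow> nat \<Rightarrow> nat" where
  "row_sum a i = (\<Sum>j\<in>{1..<i}. a i j)"

definition col_sum :: "nat \<Rightarrow> (nat \<Rightarrow> nat \<Rightarrow> nat) \<Rightarrow> nat \<Rightarrow> nat" where
  "col_sum n a j = (\<Sum>i\<in>{j<..n}. a i j)"

end

theory Submission
  imports Defs
begin

text \<open>
  Write \<open>s = nd - k\<close> for the number of derivatives that are used up when \<open>(x^q \<partial>^d)^n\<close> is
  brought into normal order. Multiplying by one more \<open>x^q \<partial>^d\<close> on the left and applying the
  Leibniz rule, \<open>m\<close> of the \<open>d\<close> new derivatives hit the power \<open>x^(qn - t)\<close> that is already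
  there, where \<open>t\<close> derivatives were used up before, and the others pass through. Hence the
  coefficients satisfy
  \<open>S_{n+1}(s) = \<Sum>_{t + m = s} S_n(t) (d choose m) (qn - t)_m\<close>.
  This recurrence defines \<open>normal_coeff\<close>, and \<open>xD_power_normal_form\<close> is the resulting operator
  identity. The coefficients in such an identity are unique, because applying it to the
  monomials \<open>x^N\<close> gives a triangular linear system with diagonal entries \<open>N!\<close>.

  The sum over arrays satisfies the same recurrence (\<open>sum_array_weight\<close>). An array with \<open>n + 1\<close>
  rows is an array \<open>a\<close> with \<open>n\<close> rows and total \<open>t\<close> together with a new last row
  \<open>b_1, ..., b_n\<close> of sum \<open>m\<close>. The new row multiplies the weight by
  \<open>(d)_m \<Prod>_j (q - c_j choose b_j)\<close>, where \<open>c_j\<close> are the column sums of \<open>a\<close>. By the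
  Vandermonde convolution, summing over all \<open>b\<close> turns the product into
  \<open>(\<Sum>_j (q - c_j) choose m) = (qn - t choose m)\<close>, and
  \<open>(d)_m (qn - t choose m) = (d choose m) (qn - t)_m\<close>.
\<close>

section \<open>Falling factorials\<close>

lemma ffact_0 [simp]: "ffact q 0 = 1"
  by (simp add: ffact_def)

lemma ffact_Suc: "ffact q (Suc m) = ffact q m * (int q - int m)"
  by (simp add: ffact_def)

lemma ffact_Suc': "ffact (Suc q) (Suc m) = int (Suc q) * ffact q m"
  unfolding ffact_def prod.lessThan_Suc_shift by simp

lemma ffact_eq_0: "q < m \<Longrightarrow> ffact q m = 0"
  by (auto simp: ffact_def)

text \<open>
  Truncated subtraction is harmless: for \<open>c > q\<close> both sides vanish.
\<close>

lemma ffact_add: "ffact q (c + b) = ffact q c * ffact (q - c) b"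
proof (cases "c \<le> q")
  case True
  show ?thesis
    by (induction b) (use True in \<open>auto simp: ffact_Suc algebra_simps of_nat_diff\<close>)
next
  case False
  then show ?thesis
    by (simp add: ffact_eq_0)
qed

lemma ffact_eq_fact_binomial: "ffact q m = int (fact m * (q choose m))"
proof (induction q arbitrary: m)
  case 0
  then show ?case
    by (cases m) (auto simp: ffact_eq_0)
next
  case (Suc q)
  show ?case
  proof (cases m)
    case (Suc l)
    have "Suc q * (q choose l) = Suc l * (Suc q choose Suc l)"
      by (metis Suc_times_binomial_eq mult.commute)
    hence "fact l * (Suc q * (q choose l)) = (fact l * (Suc l * (Suc q choose Suc l)) :: nat)"
      by simp
    hence "Suc q * (fact l * (q choose l)) = fact (Suc l) * (Suc q choose Suc l)"
      by (simp only: fact_Suc of_nat_id mult_ac)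
    then show ?thesis
      unfolding Suc ffact_Suc' Suc.IH by (metis of_nat_mult)
  qed simp
qed

section \<open>The normal ordering recurrence\<close>

lemma higher_pderiv_monom_ffact:
  "(pderiv ^^ m) (monom 1 N :: int poly) = smult (ffact N m) (monom 1 (N - m))"
proof (induction m)
  case (Suc m)
  show ?case
  proof (cases "m < N")
    case True
    then show ?thesis
      by (simp add: Suc pderiv_smult pderiv_monom ffact_Suc smult_monom of_nat_diff)
  next
    case False
    then have "ffact N (Suc m) = 0" "N - m = 0"
      by (auto simp: ffact_eq_0)
    then show ?thesis
      by (simp add: Suc pderiv_smult pderiv_monom smult_monom)
  qed
qed simp

text \<open>The general Leibniz rule.\<close>

lemma higher_pderiv_mult:
  fixes p r :: "int poly"
  shows "(pderiv ^^ m) (p * r) =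
    (\<Sum>i\<le>m. smult (of_nat (m choose i)) ((pderiv ^^ i) p * (pderiv ^^ (m - i)) r))"
proof (induction m)
  case (Suc m)
  let ?t = "\<lambda>c i j. smult (of_nat c) ((pderiv ^^ i) p * (pderiv ^^ j) r)"
  have "(pderiv ^^ Suc m) (p * r) =
      (\<Sum>i\<le>m. ?t (m choose i) i (Suc m - i)) + (\<Sum>i\<le>m. ?t (m choose i) (Suc i) (m - i))"
    by (simp add: Suc higher_pderiv_sum[where n=1, simplified] pderiv_smult pderiv_mult
        smult_add_right sum.distrib[symmetric] Suc_diff_le add_ac mult_ac)
  also have "(\<Sum>i\<le>m. ?t (m choose i) i (Suc m - i)) = (\<Sum>i\<le>Suc m. ?t (m choose i) i (Suc m - i))"
    by simp
  also have "\<dots> = ?t 1 0 (Suc m) + (\<Sum>i\<le>m. ?t (m choose Suc i) (Suc i) (m - i))"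
    by (subst sum.atMost_Suc_shift) simp
  also have "\<dots> + (\<Sum>i\<le>m. ?t (m choose i) (Suc i) (m - i)) =
      ?t 1 0 (Suc m) + (\<Sum>i\<le>m. ?t (Suc m choose Suc i) (Suc i) (m - i))"
    by (simp add: sum.distrib[symmetric] smult_add_left add_ac)
  also have "\<dots> = (\<Sum>i\<le>Suc m. ?t (Suc m choose i) i (Suc m - i))"
    by (subst sum.atMost_Suc_shift) simp
  finally show ?case .
qed simp

text \<open>
  The coefficients are indexed by the number \<open>s\<close> of derivatives that are used up; the
  Stirling number with lower index \<open>k\<close> is the one at \<open>s = nd - k\<close>. The truncation in
  \<open>q * n - t\<close> only occurs where the factor \<open>normal_coeff q d n t\<close> vanishes, if \<open>d \<le> q\<close>.
\<close>

fun normal_coeff :: "nat \<Rightarrow> nat \<Rightarrow> nat \<Rightarrow> nat \<Rightarrow> int" where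
  "normal_coeff q d 0 s = (if s = 0 then 1 else 0)"
| "normal_coeff q d (Suc n) s =
    (\<Sum>t\<le>s. normal_coeff q d n t * int (d choose (s - t)) * ffact (q * n - t) (s - t))"

lemma normal_coeff_eq_0: "n * d < s \<Longrightarrow> normal_coeff q d n s = 0"
proof (induction n arbitrary: s)
  case (Suc n)
  show ?case
    unfolding normal_coeff.simps
  proof (rule sum.neutral, rule ballI)
    fix t assume "t \<in> {..s}"
    show "normal_coeff q d n t * int (d choose (s - t)) * ffact (q * n - t) (s - t) = 0"
    proof (cases "s - t \<le> d")
      case True
      with Suc.prems have "n * d < t" by simp
      with Suc.IH show ?thesis by simp
    qed simp
  qed
qed simp

lemma xD_monom_mult:
  fixes p :: "int poly"
  shows "xD q d (monom 1 N * p) =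
    (\<Sum>m\<le>d. smult (int (d choose m) * ffact N m) (monom 1 (q + N - m) * (pderiv ^^ (d - m)) p))"
  unfolding xD_def higher_pderiv_mult higher_pderiv_monom_ffact sum_distrib_left
proof (intro sum.cong refl)
  fix m
  show "monom 1 q * smult (of_nat (d choose m)) (smult (ffact N m) (monom 1 (N - m)) *
        (pderiv ^^ (d - m)) p) =
      smult (int (d choose m) * ffact N m) (monom 1 (q + N - m) * (pderiv ^^ (d - m)) p)"
    by (cases "m \<le> N") (simp_all add: mult_monom ffact_eq_0 mult.assoc[symmetric])
qed

lemma smult_sum_right: "smult c (sum f A) = (\<Sum>x\<in>A. smult c (f x))"
  by (induction A rule: infinite_finite_induct) (simp_all add: smult_add_right)

lemma xD_smult: "xD q d (smult c p) = smult c (xD q d p)"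
  by (simp add: xD_def higher_pderiv_smult)

lemma xD_sum: "xD q d (sum f A) = (\<Sum>x\<in>A. xD q d (f x))"
  by (simp add: xD_def higher_pderiv_sum sum_distrib_left)

text \<open>
  In the induction step, a term in which \<open>t\<close> derivatives are used up yields by the Leibniz
  rule the terms with \<open>t + m\<close> used up, for \<open>m \<le> d\<close>. Collecting the terms by \<open>s = t + m\<close>
  gives the recurrence.
\<close>

lemma xD_power_normal_form:
  assumes "d \<le> q"
  shows "(xD q d ^^ n) p =
    (\<Sum>s\<le>n * d. smult (normal_coeff q d n s) (monom 1 (q * n - s) * (pderiv ^^ (n * d - s)) p))"
proof (induction n)
  case 0
  then show ?case by (simp add: monom_eq_1)
next
  case (Suc n)
  let ?c = "normal_coeff q d n"
  let ?g = "\<lambda>t m. smult (?c t * int (d choose m) * ffact (q * n - t) m)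
      (monom 1 (q * Suc n - (t + m)) * (pderiv ^^ (Suc n * d - (t + m))) p)"
  have bound: "n * d \<le> q * n"
    using assms by (simp add: mult.commute)
  have "(xD q d ^^ Suc n) p = (\<Sum>t\<le>n * d. \<Sum>m\<le>d. ?g t m)"
    unfolding funpow.simps comp_def Suc xD_sum xD_smult
  proof (intro sum.cong refl)
    fix t assume "t \<in> {..n * d}"
    then have t: "t \<le> n * d" by simp
    have "monom 1 (q + (q * n - t) - m) * (pderiv ^^ (d - m)) ((pderiv ^^ (n * d - t)) p) =
        monom 1 (q * Suc n - (t + m)) * (pderiv ^^ (Suc n * d - (t + m))) p" if "m \<le> d" for m
    proof -
      have 1: "q + (q * n - t) - m = q * Suc n - (t + m)"
        using t bound le_trans[OF t bound] by (simp del: One_nat_def)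
      have "d - m + (n * d - t) = Suc n * d - (t + m)"
        using t that by simp
      then show ?thesis
        unfolding 1 by (metis comp_apply funpow_add)
    qed
    then show "smult (?c t) (xD q d (monom 1 (q * n - t) * (pderiv ^^ (n * d - t)) p)) =
        (\<Sum>m\<le>d. ?g t m)"
      unfolding xD_monom_mult smult_sum_right
      by (intro sum.cong refl) (simp add: mult.assoc)
  qed
  also have "\<dots> = (\<Sum>(t, m)\<in>{..n * d} \<times> {..d}. ?g t m)"
    by (simp add: sum.cartesian_product)
  \<comment> \<open>The rectangle is enlarged to a triangle; outside it \<open>t > n * d\<close> or \<open>m > d\<close>, so a factor is zero.\<close>
  also have "\<dots> = (\<Sum>(t, m)\<in>{(t, m). t + m \<le> Suc n * d}. ?g t m)"
  proof (rule sum.mono_neutral_left)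
    show "finite {(t, m). t + m \<le> Suc n * d}"
      by (rule finite_subset[of _ "{..Suc n * d} \<times> {..Suc n * d}"]) auto
    show "\<forall>x\<in>{(t, m). t + m \<le> Suc n * d} - {..n * d} \<times> {..d}. (case x of (t, m) \<Rightarrow> ?g t m) = 0"
      by auto (metis normal_coeff_eq_0 not_le)
  qed auto
  also have "\<dots> = (\<Sum>s\<le>Suc n * d. \<Sum>t\<le>s. ?g t (s - t))"
    by (rule sum.triangle_reindex_eq)
  also have "\<dots> = (\<Sum>s\<le>Suc n * d. smult (normal_coeff q d (Suc n) s)
      (monom 1 (q * Suc n - s) * (pderiv ^^ (Suc n * d - s)) p))"
    by (intro sum.cong refl) (simp add: smult_sum)
  finally show ?case .
qed

lemma stirling_coeffs_normal_coeff:
  assumes "d \<le> q"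
  shows "stirling_coeffs q d n (\<lambda>k. if k \<le> n * d then normal_coeff q d n (n * d - k) else 0)"
    (is "stirling_coeffs q d n ?S")
  unfolding stirling_coeffs_def
proof (intro conjI allI)
  show "finite {k. ?S k \<noteq> 0}"
    by (rule finite_subset[of _ "{..n * d}"]) auto
  fix p :: "int poly"
  have "(\<Sum>k | ?S k \<noteq> 0. smult (?S k) (xD k k p)) = (\<Sum>k\<le>n * d. smult (?S k) (xD k k p))"
    by (rule sum.mono_neutral_left) auto
  also have "\<dots> = (\<Sum>s\<le>n * d. smult (normal_coeff q d n s) (xD (n * d - s) (n * d - s) p))"
    by (rule sum.reindex_bij_witness[of _ "\<lambda>s. n * d - s" "\<lambda>s. n * d - s"]) auto
  finally have eq: "(\<Sum>k | ?S k \<noteq> 0. smult (?S k) (xD k k p)) = \<dots>" .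
  show "(xD q d ^^ n) p = monom 1 ((q - d) * n) * (\<Sum>k | ?S k \<noteq> 0. smult (?S k) (xD k k p))"
    unfolding eq xD_power_normal_form[OF assms] sum_distrib_left
  proof (intro sum.cong refl)
    fix s assume "s \<in> {..n * d}"
    moreover have "(q - d) * n + n * d = q * n"
      using assms by (metis add_mult_distrib le_add_diff_inverse2 mult.commute)
    ultimately have "q * n - s = (q - d) * n + (n * d - s)"
      by simp
    then show "smult (normal_coeff q d n s) (monom 1 (q * n - s) * (pderiv ^^ (n * d - s)) p) =
        monom 1 ((q - d) * n) * smult (normal_coeff q d n s) (xD (n * d - s) (n * d - s) p)"
      by (simp add: xD_def mult.assoc[symmetric] mult_monom)
  qed
qed

text \<open>
  Applied to \<open>x^N\<close>, every term of the identity is a multiple of the same power of \<open>x\<close>.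
  Evaluation at \<open>1\<close> keeps the multipliers only, and these vanish for \<open>k > N\<close>.
\<close>

lemma stirling_coeffs_monom:
  assumes "stirling_coeffs q d n S"
  shows "poly ((xD q d ^^ n) (monom 1 N)) 1 = (\<Sum>k\<le>N. S k * ffact N k)"
proof -
  have fin: "finite {k. S k \<noteq> 0}"
    using assms by (simp add: stirling_coeffs_def)
  have "poly ((xD q d ^^ n) (monom 1 N)) 1 = (\<Sum>k | S k \<noteq> 0. S k * ffact N k)"
    using assms
    by (simp add: stirling_coeffs_def poly_monom poly_sum xD_def higher_pderiv_monom_ffact)
  also have "\<dots> = (\<Sum>k\<in>{k. S k \<noteq> 0} \<union> {..N}. S k * ffact N k)"
    by (rule sum.mono_neutral_left) (use fin in auto)
  also have "\<dots> = (\<Sum>k\<le>N. S k * ffact N k)"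
    by (rule sum.mono_neutral_right) (use fin in \<open>auto simp: ffact_eq_0\<close>)
  finally show ?thesis .
qed

text \<open>
  The equations for \<open>N = 0, 1, 2, ...\<close> form a triangular system with diagonal entries
  \<open>(N)_N = N!\<close>, so they determine the coefficients one after the other.
\<close>

lemma stirling_coeffs_unique:
  assumes "stirling_coeffs q d n S" "stirling_coeffs q d n T"
  shows "S = T"
proof
  fix N
  show "S N = T N"
  proof (induction N rule: less_induct)
    case (less N)
    have "(\<Sum>k\<le>N. S k * ffact N k) = (\<Sum>k\<le>N. T k * ffact N k)"
      using stirling_coeffs_monom[OF assms(1)] stirling_coeffs_monom[OF assms(2)] by metis
    moreover have "(\<Sum>k<N. S k * ffact N k) = (\<Sum>k<N. T k * ffact N k)"
      by (rule sum.cong) (auto simp: less)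
    ultimately have "S N * ffact N N = T N * ffact N N"
      by (simp add: lessThan_Suc_atMost[symmetric])
    then show ?case
      by (simp add: ffact_eq_fact_binomial)
  qed
qed

lemma gen_stirling_eq_normal_coeff:
  assumes "d \<le> q"
  shows "gen_stirling q d n k = (if k \<le> n * d then normal_coeff q d n (n * d - k) else 0)"
proof -
  have "gen_stirling q d n = (\<lambda>k. if k \<le> n * d then normal_coeff q d n (n * d - k) else 0)"
    unfolding gen_stirling_def
    by (rule the_equality)
      (use stirling_coeffs_normal_coeff[OF assms] stirling_coeffs_unique in blast)+
  then show ?thesis by simp
qed

section \<open>Vectors of given sum and the Vandermonde convolution\<close>

text \<open>
  As for the arrays, a vector indexed by \<open>A\<close> is a function that vanishes off \<open>A\<close>. These
  vectors are the rows that get appended to an array.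
\<close>

definition vectors :: "'a set \<Rightarrow> nat \<Rightarrow> ('a \<Rightarrow> nat) set" where
  "vectors A m = {b. (\<forall>x. x \<notin> A \<longrightarrow> b x = 0) \<and> sum b A = m}"

lemma vectors_empty: "vectors {} m = (if m = 0 then {\<lambda>_. 0} else {})"
  by (auto simp: vectors_def)

lemma bij_betw_vectors_insert:
  assumes "finite A" "x \<notin> A"
  shows "bij_betw (\<lambda>(l, b). b(x := l)) (SIGMA l:{..m}. vectors A (m - l)) (vectors (insert x A) m)"
proof (rule bij_betw_byWitness[where f' = "\<lambda>b. (b x, b(x := 0))"])
  have upd: "sum (b(x := l)) A = sum b A" for b :: "'a \<Rightarrow> nat" and l
    by (rule sum.cong) (use assms in auto)
  show "(\<lambda>(l, b). b(x := l)) ` (SIGMA l:{..m}. vectors A (m - l)) \<subseteq> vectors (insert x A) m"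
    using assms by (auto simp: vectors_def upd simp del: fun_upd_apply) (auto)
  show "(\<lambda>b. (b x, b(x := 0))) ` vectors (insert x A) m \<subseteq> (SIGMA l:{..m}. vectors A (m - l))"
    using assms by (auto simp: vectors_def upd simp del: fun_upd_apply) (auto)
  show "\<forall>z\<in>SIGMA l:{..m}. vectors A (m - l). ((case z of (l, b) \<Rightarrow> b(x := l)) x,
      (case z of (l, b) \<Rightarrow> b(x := l))(x := 0)) = z"
    using assms by (auto simp: vectors_def fun_eq_iff)
qed auto

lemma finite_vectors:
  assumes "finite A"
  shows "finite (vectors A m)"
  using assms
proof (induction A arbitrary: m)
  case (insert x A)
  then show ?case
    using bij_betw_finite[OF bij_betw_vectors_insert[of A x m]] by auto
qed (simp add: vectors_empty)

text \<open>
  Both sides count the subsets of size \<open>m\<close> of a disjoint union of sets of sizes \<open>N x\<close>; the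
  left-hand side sorts them by the number \<open>b x\<close> of elements taken from each part. Splitting
  off one part at a time reduces this to the convolution for two binomial coefficients.
\<close>

lemma vandermonde_vectors:
  assumes "finite A"
  shows "(\<Sum>b\<in>vectors A m. \<Prod>x\<in>A. N x choose b x) = (sum N A choose m)"
  using assms
proof (induction A arbitrary: m)
  case (insert x A)
  have "(\<Sum>b\<in>vectors (insert x A) m. \<Prod>y\<in>insert x A. N y choose b y) =
      (\<Sum>(l, b)\<in>(SIGMA l:{..m}. vectors A (m - l)). (N x choose l) * (\<Prod>y\<in>A. N y choose b y))"
  proof (subst sum.reindex_bij_betw[OF bij_betw_vectors_insert[OF insert.hyps], symmetric],
      intro sum.cong refl, clarify)
    fix l b
    have "(\<Prod>y\<in>A. N y choose (b(x := l)) y) = (\<Prod>y\<in>A. N y choose b y)"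
      by (rule prod.cong) (use insert.hyps in auto)
    then show "(\<Prod>y\<in>insert x A. N y choose (b(x := l)) y) =
        (N x choose l) * (\<Prod>y\<in>A. N y choose b y)"
      using insert.hyps by simp
  qed
  also have "\<dots> = (\<Sum>l\<le>m. (N x choose l) * (sum N A choose (m - l)))"
    by (subst sum.Sigma[symmetric])
      (simp_all add: finite_vectors insert.hyps sum_distrib_left[symmetric] insert.IH)
  also have "\<dots> = (N x + sum N A choose m)"
    by (rule vandermonde)
  finally show ?case
    using insert.hyps by simp
qed (simp add: vectors_empty)

section \<open>Triangular arrays\<close>

lemma tri_index_Sigma: "tri_index n = (SIGMA i:{1..n}. {1..<i})"
  by (auto simp: tri_index_def)

definition arrays_of_sum :: "nat \<Rightarrow> nat \<Rightarrow> (nat \<Rightarrow> nat \<Rightarrow> nat) set" where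
  "arrays_of_sum n s = {a \<in> tri_arrays n. (\<Sum>(i, j)\<in>tri_index n. a i j) = s}"

text \<open>
  The factors for row \<open>1\<close> and column \<open>n\<close>, which contain no entries, are \<open>(d)_0 = (q)_0 = 1\<close>.
  Including them makes the step from \<open>n\<close> to \<open>n + 1\<close> uniform, also at \<open>n = 0\<close>.
\<close>

definition array_weight :: "nat \<Rightarrow> nat \<Rightarrow> nat \<Rightarrow> (nat \<Rightarrow> nat \<Rightarrow> nat) \<Rightarrow> rat" where
  "array_weight q d n a =
     of_int ((\<Prod>i\<in>{1..n}. ffact d (row_sum a i)) * (\<Prod>j\<in>{1..n}. ffact q (col_sum n a j)))
     / of_nat (\<Prod>i\<in>{1..n}. \<Prod>j\<in>{1..<i}. fact (a i j))"

lemma array_weight_eq: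
  "array_weight q d n a =
     of_int ((\<Prod>i\<in>{2..n}. ffact d (row_sum a i)) * (\<Prod>j\<in>{1..<n}. ffact q (col_sum n a j)))
     / of_nat (\<Prod>(i, j)\<in>tri_index n. fact (a i j))"
proof -
  have "(\<Prod>i\<in>{1..n}. ffact d (row_sum a i)) = (\<Prod>i\<in>{2..n}. ffact d (row_sum a i))"
    by (rule prod.mono_neutral_right) (auto simp: row_sum_def not_le less_Suc_eq)
  moreover have "(\<Prod>j\<in>{1..n}. ffact q (col_sum n a j)) = (\<Prod>j\<in>{1..<n}. ffact q (col_sum n a j))"
    by (rule prod.mono_neutral_right) (auto simp: col_sum_def)
  moreover have "(\<Prod>i\<in>{1..n}. \<Prod>j\<in>{1..<i}. fact (a i j)) =
      (\<Prod>(i, j)\<in>tri_index n. fact (a i j) :: nat)"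
    unfolding tri_index_Sigma by (rule prod.Sigma) auto
  ultimately show ?thesis
    by (simp add: array_weight_def)
qed

lemma sum_tri_index_rows: "(\<Sum>(i, j)\<in>tri_index n. a i j) = (\<Sum>i\<in>{1..n}. row_sum a i)"
  unfolding tri_index_Sigma row_sum_def by (rule sum.Sigma[symmetric]) auto

lemma sum_tri_index_cols: "(\<Sum>(i, j)\<in>tri_index n. a i j) = (\<Sum>j\<in>{1..n}. col_sum n a j)"
proof -
  have "(\<Sum>(i, j)\<in>tri_index n. a i j) = (\<Sum>(j, i)\<in>(SIGMA j:{1..n}. {j<..n}). a i j)"
    by (rule sum.reindex_bij_witness[of _ prod.swap prod.swap]) (auto simp: tri_index_def)
  also have "\<dots> = (\<Sum>j\<in>{1..n}. col_sum n a j)"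
    unfolding col_sum_def by (rule sum.Sigma[symmetric]) auto
  finally show ?thesis .
qed

lemma row_sum_upd_same: "row_sum (a(Suc n := b)) (Suc n) = sum b {1..n}"
  by (simp add: row_sum_def atLeastLessThanSuc_atLeastAtMost)

lemma row_sum_upd_other: "i \<noteq> Suc n \<Longrightarrow> row_sum (a(Suc n := b)) i = row_sum a i"
  by (simp add: row_sum_def)

lemma sum_tri_index_upd:
  fixes b :: "nat \<Rightarrow> nat"
  shows "(\<Sum>(i, j)\<in>tri_index (Suc n). (a(Suc n := b)) i j) =
    (\<Sum>(i, j)\<in>tri_index n. a i j) + sum b {1..n}"
  unfolding sum_tri_index_rows
  by (simp add: row_sum_upd_same row_sum_upd_other del: fun_upd_apply)

lemma col_sum_upd:
  assumes "j \<le> n"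
  shows "col_sum (Suc n) (a(Suc n := b)) j = col_sum n a j + b j"
proof -
  have "{j<..Suc n} = insert (Suc n) {j<..n}"
    using assms by auto
  then show ?thesis
    by (simp add: col_sum_def)
qed

text \<open>Deleting the last row is inverse to appending it.\<close>

lemma bij_betw_arrays_Suc:
  "bij_betw (\<lambda>(t, a, b). a(Suc n := b))
    (SIGMA t:{..s}. arrays_of_sum n t \<times> vectors {1..n} (s - t)) (arrays_of_sum (Suc n) s)"
  (is "bij_betw ?f ?A ?B")
proof (rule bij_betw_byWitness[where f' = "\<lambda>a. (s - sum (a (Suc n)) {1..n}, a(Suc n := \<lambda>_. 0), a (Suc n))"])
  show "?f ` ?A \<subseteq> ?B"
    by (auto simp: arrays_of_sum_def vectors_def sum_tri_index_upd simp del: fun_upd_apply)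
      (auto simp: tri_arrays_def tri_index_def)
  have "sum (a (Suc n)) {1..n} \<le> s \<and> a(Suc n := \<lambda>_. 0) \<in> tri_arrays n \<and>
      (\<Sum>(i, j)\<in>tri_index n. (a(Suc n := \<lambda>_. 0)) i j) = s - sum (a (Suc n)) {1..n} \<and>
      a (Suc n) \<in> vectors {1..n} (sum (a (Suc n)) {1..n})" if "a \<in> ?B" for a
  proof (intro conjI)
    have s: "s = (\<Sum>(i, j)\<in>tri_index n. (a(Suc n := \<lambda>_. 0)) i j) + sum (a (Suc n)) {1..n}"
      using that sum_tri_index_upd[where n = n and a = "a(Suc n := \<lambda>_. 0)" and b = "a (Suc n)"]
      unfolding fun_upd_upd fun_upd_triv arrays_of_sum_def by blast
    then show "sum (a (Suc n)) {1..n} \<le> s"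
      and "(\<Sum>(i, j)\<in>tri_index n. (a(Suc n := \<lambda>_. 0)) i j) = s - sum (a (Suc n)) {1..n}"
      by linarith+
    show "a(Suc n := \<lambda>_. 0) \<in> tri_arrays n" "a (Suc n) \<in> vectors {1..n} (sum (a (Suc n)) {1..n})"
      using that by (auto simp: arrays_of_sum_def tri_arrays_def tri_index_def vectors_def)
  qed
  then show "(\<lambda>a. (s - sum (a (Suc n)) {1..n}, a(Suc n := \<lambda>_. 0), a (Suc n))) ` ?B \<subseteq> ?A"
    by (auto simp: arrays_of_sum_def simp del: fun_upd_apply)
  show "\<forall>z\<in>?A. (s - sum (?f z (Suc n)) {1..n}, (?f z)(Suc n := \<lambda>_. 0), ?f z (Suc n)) = z"
    by (auto simp: arrays_of_sum_def tri_arrays_def tri_index_def vectors_def fun_eq_iff)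
qed auto

lemma arrays_of_sum_0: "arrays_of_sum 0 s = (if s = 0 then {\<lambda>_ _. 0} else {})"
proof -
  have "tri_index 0 = {}"
    by (auto simp: tri_index_def)
  then show ?thesis
    by (auto simp: arrays_of_sum_def tri_arrays_def fun_eq_iff)
qed

lemma finite_arrays_of_sum: "finite (arrays_of_sum n s)"
proof (induction n arbitrary: s)
  case (Suc n)
  then show ?case
    using bij_betw_finite[OF bij_betw_arrays_Suc[of n s]] by (auto simp: finite_vectors)
qed (simp add: arrays_of_sum_0)

text \<open>
  The entry \<open>b j\<close> raises the sum of column \<open>j\<close> from \<open>c\<close> to \<open>c + b j\<close>. The column factor changes
  from \<open>(q)_c\<close> to \<open>(q)_c (q - c)_{b j}\<close>, and dividing by the new factorial \<open>(b j)!\<close> turns the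
  additional factor into a binomial coefficient.
\<close>

lemma array_weight_upd:
  assumes "b \<in> vectors {1..n} m"
  shows "array_weight q d (Suc n) (a(Suc n := b)) =
    array_weight q d n a * of_int (ffact d m) *
      of_nat (\<Prod>j\<in>{1..n}. (q - col_sum n a j) choose b j)"
proof -
  let ?a = "a(Suc n := b)"
  have rows: "(\<Prod>i\<in>{1..Suc n}. ffact d (row_sum ?a i)) =
      (\<Prod>i\<in>{1..n}. ffact d (row_sum a i)) * ffact d m"
    using assms by (simp add: row_sum_upd_same row_sum_upd_other vectors_def)
  have "ffact q (col_sum (Suc n) ?a j) = ffact q (col_sum n a j) *
      int (fact (b j) * ((q - col_sum n a j) choose b j))" if "j \<in> {1..n}" for j
    using that by (simp add: col_sum_upd ffact_add ffact_eq_fact_binomial[of "q - _"])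
  moreover have "col_sum (Suc n) ?a (Suc n) = 0"
    by (simp add: col_sum_def)
  ultimately have cols: "(\<Prod>j\<in>{1..Suc n}. ffact q (col_sum (Suc n) ?a j)) =
      (\<Prod>j\<in>{1..n}. ffact q (col_sum n a j)) *
      int ((\<Prod>j\<in>{1..n}. fact (b j)) * (\<Prod>j\<in>{1..n}. (q - col_sum n a j) choose b j))"
    by (simp add: prod.distrib)
  have facts: "(\<Prod>i\<in>{1..Suc n}. \<Prod>j\<in>{1..<i}. fact (?a i j) :: nat) =
      (\<Prod>i\<in>{1..n}. \<Prod>j\<in>{1..<i}. fact (a i j)) * (\<Prod>j\<in>{1..n}. fact (b j))"
    by (simp add: atLeastLessThanSuc_atLeastAtMost)
  have "(\<Prod>j\<in>{1..n}. fact (b j) :: nat) \<noteq> 0"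
    by simp
  then show ?thesis
    unfolding array_weight_def rows cols facts of_int_mult of_nat_mult of_int_of_nat_eq
    by simp
qed

text \<open>
  The Vandermonde convolution produces \<open>\<Sum>_j (q - c_j)\<close> with truncated differences. If all
  column sums \<open>c_j\<close> are at most \<open>q\<close>, this is \<open>qn - t\<close>; otherwise \<open>a\<close> has weight zero.
\<close>

lemma sum_array_weight_upd:
  assumes "a \<in> arrays_of_sum n t"
  shows "(\<Sum>b\<in>vectors {1..n} m. array_weight q d (Suc n) (a(Suc n := b))) =
    array_weight q d n a * of_int (int (d choose m) * ffact (q * n - t) m)"
proof -
  let ?w = "array_weight q d n a * of_int (ffact d m)"
  have "(\<Sum>b\<in>vectors {1..n} m. array_weight q d (Suc n) (a(Suc n := b))) =
      (\<Sum>b\<in>vectors {1..n} m. ?w * of_nat (\<Prod>j\<in>{1..n}. (q - col_sum n a j) choose b j))"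
    by (intro sum.cong refl array_weight_upd)
  also have "\<dots> = ?w * of_nat ((\<Sum>j\<in>{1..n}. q - col_sum n a j) choose m)"
    unfolding sum_distrib_left[symmetric] of_nat_sum[symmetric]
    by (simp only: vandermonde_vectors finite_atLeastAtMost)
  also have "\<dots> = ?w * of_nat ((q * n - t) choose m)"
  proof (cases "\<forall>j\<in>{1..n}. col_sum n a j \<le> q")
    case True
    have "(\<Sum>j\<in>{1..n}. q - col_sum n a j) = (\<Sum>j\<in>{1..n}. q) - (\<Sum>j\<in>{1..n}. col_sum n a j)"
      using True by (intro sum_subtractf_nat) auto
    also have "\<dots> = q * n - t"
      using assms by (simp add: arrays_of_sum_def sum_tri_index_cols mult.commute)
    finally show ?thesis by simp
  next
    case False
    then have "(\<Prod>j\<in>{1..n}. ffact q (col_sum n a j)) = 0"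
      by (intro prod_zero) (auto simp: not_le intro: ffact_eq_0)
    then have "array_weight q d n a = 0"
      by (simp add: array_weight_def)
    then show ?thesis by simp
  qed
  also have "\<dots> = array_weight q d n a * of_int (int (d choose m) * ffact (q * n - t) m)"
    by (simp add: ffact_eq_fact_binomial)
  finally show ?thesis .
qed

lemma sum_array_weight:
  "(\<Sum>a\<in>arrays_of_sum n s. array_weight q d n a) = of_int (normal_coeff q d n s)"
proof (induction n arbitrary: s)
  case 0
  then show ?case
    by (simp add: arrays_of_sum_0 array_weight_def)
next
  case (Suc n)
  have "(\<Sum>a\<in>arrays_of_sum (Suc n) s. array_weight q d (Suc n) a) =
      (\<Sum>(t, a, b)\<in>(SIGMA t:{..s}. arrays_of_sum n t \<times> vectors {1..n} (s - t)).
        array_weight q d (Suc n) (a(Suc n := b)))"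
    by (subst sum.reindex_bij_betw[OF bij_betw_arrays_Suc, symmetric])
      (simp add: case_prod_unfold)
  also have "\<dots> = (\<Sum>t\<le>s. \<Sum>a\<in>arrays_of_sum n t. \<Sum>b\<in>vectors {1..n} (s - t).
      array_weight q d (Suc n) (a(Suc n := b)))"
    by (simp add: sum.Sigma sum.cartesian_product finite_arrays_of_sum finite_vectors)
  also have "\<dots> = (\<Sum>t\<le>s. \<Sum>a\<in>arrays_of_sum n t.
      array_weight q d n a * of_int (int (d choose (s - t)) * ffact (q * n - t) (s - t)))"
    by (intro sum.cong refl sum_array_weight_upd)
  also have "\<dots> = of_int (normal_coeff q d (Suc n) s)"
    by (simp add: sum_distrib_right[symmetric] Suc.IH mult.assoc)
  finally show ?case .
qed

theorem corollary6p20: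
  fixes q d n k :: nat
  assumes "d \<le> q"
  shows "(of_int (gen_stirling q d n k) :: rat) =
    (\<Sum>a | a \<in> tri_arrays n \<and> int (\<Sum>(i, j)\<in>tri_index n. a i j) = int (n * d) - int k.
       of_int ((\<Prod>i\<in>{2..n}. ffact d (row_sum a i)) * (\<Prod>j\<in>{1..<n}. ffact q (col_sum n a j)))
       / of_nat (\<Prod>(i, j)\<in>tri_index n. fact (a i j)))"
proof -
  \<comment> \<open>For \<open>k > n * d\<close> no array has the required negative total, and the Stirling number is zero.\<close>
  have index: "{a. a \<in> tri_arrays n \<and> int (\<Sum>(i, j)\<in>tri_index n. a i j) = int (n * d) - int k} =
      (if k \<le> n * d then arrays_of_sum n (n * d - k) else {})"
  proof -
    have "int t = int (n * d) - int k \<longleftrightarrow> k \<le> n * d \<and> t = n * d - k" for t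
      by linarith
    then show ?thesis
      unfolding arrays_of_sum_def by (simp only:) auto
  qed
  show ?thesis
    unfolding index array_weight_eq[symmetric] gen_stirling_eq_normal_coeff[OF assms]
    by (simp add: sum_array_weight)
qed

end
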